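(* (i) Assume that $p_{12}=p_{21}^{-1}\neq1$. Then: (1) $\overline{l}_{1}^{m}[2]^-\neq0$ if and only if $\mathrm{ord}(p_{11})>m\ge0$. (2) $\overline{l}_{2}^{m}[1]^-\neq0$ if and only if $\mathrm{ord}(p_{22})>m\ge0$. (ii) (1) Assume that $m_{12}=\mathrm{ord}(p_{11})-1$ and $p_{12}p_{21}\neq1$. Then $\overline{l}_{1}^{m}[2]^-\neq0$ if and only if $0\le m\le m_{12}-1+\mathrm{ord}(p_{11})$. (2) Assume that $m_{21}=\mathrm{ord}(p_{22})-1$ and $p_{12}p_{21}\neq1$. Then $\overline{l}_{2}^{m}[1]^-\neq0$ if and only if $0\le m\le m_{21}-1+\mathrm{ord}(p_{22})$.
   Context: $F$ is an algebraically closed field of characteristic zero. $V$ is a braided vector space of diagonal type over $F$ with basis $x_1,x_2,\dots,x_n$ ($n\ge2$) and braiding $C(x_i\otimes x_j)=p_{ij}\,x_j\otimes x_i$, $p_{ij}\in F\setminus\{0\}$; $\mathfrak B(V)$ is its Nichols algebra. $\mathrm{ord}(q)$ denotes the order of $q\in F\setminus\{0\}$ with respect to multiplication ($\infty$ if $q$ is not a root of unity). For $\{i,j\}=\{1,2\}$, $m_{ij}$ is the minimum (when it exists) of the set of $m\in\mathbb N_0$ such that $p_{ii}^{m}p_{ij}p_{ji}=1$, or $p_{ii}^{m+1}=1$ and $p_{ii}\neq1$. Iterated commutators in $\mathfrak B(V)$: with $[x,y]^-=yx-xy$, put $\overline l_i^{0}[j]^-=x_j$ and $\overline l_i^{m}[j]^-=[x_i,\overline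 l_i^{m-1}[j]^-]^-$ for integers $m\ge1$. Here $m$ ranges over the non-negative integers.
   Formalization: Part (i)(1) is stated with the added assumption p_11≠1 and (i)(2) with p_22≠1: since ord(1)=1, the printed claim fails for p_ii=1, where the iterated commutators are nonzero for all m. *)

theory Defs
  imports
    "HOL-Algebra.QuotRing"
    "HOL-Computational_Algebra.Polynomial"
    "HOL-Library.Extended_Nat"
begin

section \<open>The tensor algebra\<close>

text \<open>
  The space \<open>V\<close> has basis \<open>x\<^sub>1, \<dots>, x\<^sub>n\<close>. An element of \<open>T(V)\<close> is the finitely supported
  family of its coefficients with respect to the basis of words in the letters \<open>1, \<dots>, n\<close>:
  the word \<open>[i\<^sub>1, \<dots>, i\<^sub>m]\<close> stands for the basis vector \<open>x\<^bsub>i\<^sub>1\<^esub> \<otimes> \<dots> \<otimes> x\<^bsub>i\<^sub>m\<^esub>\<close>.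
\<close>

definition tensor_algebra :: "nat \<Rightarrow> (nat list \<Rightarrow> 'f::field) ring" where
  "tensor_algebra n =
    \<lparr>carrier = {u. finite {w. u w \<noteq> 0} \<and> (\<forall>w. u w \<noteq> 0 \<longrightarrow> set w \<subseteq> {1..n})},
     monoid.mult = (\<lambda>u v w. \<Sum>k\<le>length w. u (take k w) * v (drop k w)),
     one = (\<lambda>w. if w = [] then 1 else 0),
     zero = (\<lambda>w. 0),
     add = (\<lambda>u v w. u w + v w)\<rparr>"

definition word_vec :: "nat list \<Rightarrow> nat list \<Rightarrow> 'f::field" where
  "word_vec v = (\<lambda>w. if w = v then 1 else 0)"

section \<open>Braiding and quantum symmetrizers\<close>

text \<open>
  \<open>braid_at p k\<close> is \<open>id\<^bsup>k\<^esup> \<otimes> C \<otimes> id\<close> on tensors of degree at least \<open>k + 2\<close>, where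
  \<open>C(x\<^sub>i \<otimes> x\<^sub>j) = p\<^sub>i\<^sub>j x\<^sub>j \<otimes> x\<^sub>i\<close> (letters of a word are counted from \<open>0\<close>). The definition acts
  on coefficients, so the coefficient at \<open>w\<close> comes from the word with the two letters exchanged;
  \<open>braid_at_word_vec\<close> is the resulting formula on basis words.
\<close>

definition braid_at :: "(nat \<Rightarrow> nat \<Rightarrow> 'f::field) \<Rightarrow> nat \<Rightarrow> (nat list \<Rightarrow> 'f) \<Rightarrow> nat list \<Rightarrow> 'f" where
  "braid_at p k u =
    (\<lambda>w. p (w ! Suc k) (w ! k) * u (w[k := w ! Suc k, Suc k := w ! k]))"

lemma braid_at_word_vec:
  assumes "length w = length (a @ [i, j] @ b)"
  shows "braid_at p (length a) (word_vec (a @ [i, j] @ b)) w = p i j * word_vec (a @ [j, i] @ b) w"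
proof -
  let ?k = "length a"
  obtain a' r where w1: "w = a' @ r" and la: "length a' = ?k" and lr: "length r = Suc (Suc (length b))"
    using assms
    by (metis (no_types, lifting) add_left_cancel append_take_drop_id length_Cons length_append
        length_take min.absorb2 le_add1 append_Cons append_Nil)
  obtain x y b' where r: "r = x # y # b'"
    using lr by (metis Suc_length_conv)
  have w: "w = a' @ [x, y] @ b'" using w1 r by simp
  have nth: "w ! ?k = x" "w ! Suc ?k = y"
    unfolding w la[symmetric] by (simp_all add: nth_append)
  have upd: "w[?k := y, Suc ?k := x] = a' @ [y, x] @ b'"
    unfolding w la[symmetric] by (simp add: list_update_append)
  have "braid_at p ?k (word_vec (a @ [i, j] @ b)) w
      = p y x * (if a' @ [y, x] @ b' = a @ [i, j] @ b then 1 else 0)"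
    unfolding braid_at_def word_vec_def nth upd ..
  moreover have "a' @ [y, x] @ b' = a @ [i, j] @ b \<longleftrightarrow> a' = a \<and> y = i \<and> x = j \<and> b' = b"
    "w = a @ [j, i] @ b \<longleftrightarrow> a' = a \<and> y = i \<and> x = j \<and> b' = b"
    unfolding w using la by auto
  ultimately show ?thesis
    unfolding word_vec_def by auto
qed

text \<open>
  Braided integers \<open>[m]\<close> and factorials \<open>[m]!\<close>. Writing \<open>C\<^sub>k\<close> for \<open>braid_at p k\<close>,
  \<open>[m] = id + C\<^bsub>m-2\<^esub> + C\<^bsub>m-2\<^esub> C\<^bsub>m-3\<^esub> + \<dots> + C\<^bsub>m-2\<^esub> \<dots> C\<^sub>0\<close> and \<open>[m]! = ([m-1]! \<otimes> id) [m]\<close>.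
  The products \<open>C\<^bsub>m-2\<^esub> \<dots> C\<^sub>k\<close> are the lifts of the minimal coset representatives of
  \<open>S\<^bsub>m-1\<^esub>\<close> in \<open>S\<^sub>m\<close>, so \<open>[m]!\<close> on \<open>V\<^bsup>\<otimes>m\<^esup>\<close> is the quantum symmetrizer, the sum over all
  \<open>\<sigma> \<in> S\<^sub>m\<close> of the braid lifts of \<open>\<sigma>\<close>. Tensoring with \<open>id\<close> on the right needs no notation,
  because \<open>C\<^sub>k\<close> is defined on all longer words too.
\<close>

fun braided_int ::
    "(nat \<Rightarrow> nat \<Rightarrow> 'f::field) \<Rightarrow> nat \<Rightarrow> (nat list \<Rightarrow> 'f) \<Rightarrow> nat list \<Rightarrow> 'f" where
  "braided_int p 0 u = (\<lambda>w. 0)"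
| "braided_int p (Suc 0) u = u"
| "braided_int p (Suc (Suc m)) u = (\<lambda>w. u w + braid_at p m (braided_int p (Suc m) u) w)"

fun quantum_symmetrizer ::
    "(nat \<Rightarrow> nat \<Rightarrow> 'f::field) \<Rightarrow> nat \<Rightarrow> (nat list \<Rightarrow> 'f) \<Rightarrow> nat list \<Rightarrow> 'f" where
  "quantum_symmetrizer p 0 u = u"
| "quantum_symmetrizer p (Suc m) u = quantum_symmetrizer p m (braided_int p (Suc m) u)"

section \<open>The Nichols algebra\<close>

definition degree_part :: "nat \<Rightarrow> (nat list \<Rightarrow> 'f::field) \<Rightarrow> nat list \<Rightarrow> 'f" where
  "degree_part m u = (\<lambda>w. if length w = m then u w else 0)"

text \<open>
  The defining ideal of the Nichols algebra is the direct sum over \<open>m\<close> of the kernels of the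
  quantum symmetrizers on \<open>V\<^bsup>\<otimes>m\<^esup>\<close>.
\<close>

definition nichols_ideal ::
    "nat \<Rightarrow> (nat \<Rightarrow> nat \<Rightarrow> 'f::field) \<Rightarrow> (nat list \<Rightarrow> 'f) set" where
  "nichols_ideal n p =
    {u \<in> carrier (tensor_algebra n).
      \<forall>m w. length w = m \<longrightarrow> quantum_symmetrizer p m (degree_part m u) w = 0}"

definition nichols_algebra ::
    "nat \<Rightarrow> (nat \<Rightarrow> nat \<Rightarrow> 'f::field) \<Rightarrow> (nat list \<Rightarrow> 'f) set ring" where
  "nichols_algebra n p = tensor_algebra n Quot nichols_ideal n p"

definition nichols_gen ::
    "nat \<Rightarrow> (nat \<Rightarrow> nat \<Rightarrow> 'f::field) \<Rightarrow> nat \<Rightarrow> (nat list \<Rightarrow> 'f) set" where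
  "nichols_gen n p i = nichols_ideal n p +>\<^bsub>tensor_algebra n\<^esub> word_vec [i]"

text \<open>Note the order of the factors: \<open>[x, y]\<^sup>- = yx - xy\<close>.\<close>

definition comm_minus :: "('a, 'b) ring_scheme \<Rightarrow> 'a \<Rightarrow> 'a \<Rightarrow> 'a" where
  "comm_minus R x y = (y \<otimes>\<^bsub>R\<^esub> x) \<ominus>\<^bsub>R\<^esub> (x \<otimes>\<^bsub>R\<^esub> y)"

text \<open>\<open>iter_comm n p i j m\<close> is \<open>l\<^sub>i\<^sup>m[j]\<^sup>-\<close> (with a bar over \<open>l\<close>).\<close>

primrec iter_comm ::
    "nat \<Rightarrow> (nat \<Rightarrow> nat \<Rightarrow> 'f::field) \<Rightarrow> nat \<Rightarrow> nat \<Rightarrow> nat \<Rightarrow> (nat list \<Rightarrow> 'f) set" where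
  "iter_comm n p i j 0 = nichols_gen n p j"
| "iter_comm n p i j (Suc m) =
    comm_minus (nichols_algebra n p) (nichols_gen n p i) (iter_comm n p i j m)"

section \<open>Orders and the numbers \<open>m\<^sub>i\<^sub>j\<close>\<close>

definition mult_ord :: "'f::field \<Rightarrow> enat" where
  "mult_ord q =
    (if \<exists>k>0. q ^ k = 1 then enat (LEAST k. k > 0 \<and> q ^ k = 1) else \<infinity>)"

definition cartan_exponents :: "(nat \<Rightarrow> nat \<Rightarrow> 'f::field) \<Rightarrow> nat \<Rightarrow> nat \<Rightarrow> nat set" where
  "cartan_exponents p i j =
    {m. p i i ^ m * p i j * p j i = 1 \<or> (p i i ^ (m + 1) = 1 \<and> p i i \<noteq> 1)}"

text \<open>Meaningful only if \<open>cartan_exponents p i j\<close> is nonempty.\<close>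

definition cartan_m :: "(nat \<Rightarrow> nat \<Rightarrow> 'f::field) \<Rightarrow> nat \<Rightarrow> nat \<Rightarrow> nat" where
  "cartan_m p i j = (LEAST m. m \<in> cartan_exponents p i j)"

end

theory Submission
  imports Defs "HOL-Library.Function_Algebras"
begin

text \<open>
  Write \<open>x = x\<^sub>i\<close>, \<open>y = x\<^sub>j\<close>, \<open>q = p\<^sub>i\<^sub>i\<close>, \<open>a = p\<^sub>i\<^sub>j\<close>, \<open>b = p\<^sub>j\<^sub>i\<close> for the two letters \<open>{i, j} = {1, 2}\<close>.

  Membership in the Nichols ideal is tested by the right skew derivations \<open>D\<^sub>k\<close>, defined on words
  by splitting off one letter \<open>k\<close> after braiding it to the right end. They satisfy
  \<open>D\<^sub>k(uv) = u D\<^sub>k(v) + D\<^sub>k(u) T\<^sub>k(v)\<close> where \<open>T\<^sub>k\<close> multiplies a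
  word by the product of the \<open>p\<^sub>k\<^sub>l\<close> over its letters \<open>l\<close> (\<open>skew_der_conv\<close>).
  The quantum symmetrizer of an element of degree \<open>m\<close> has as its coefficients the iterated
  derivatives of order \<open>m\<close> (\<open>quantum_symmetrizer_eq_foldr_skew_der\<close>), so \<open>u\<close> vanishes in the
  Nichols algebra iff every iterated derivative of \<open>u\<close> has constant term \<open>0\<close>; the product rule
  shows that this condition defines a two-sided ideal. Since \<open>D\<^sub>i(x\<^sup>m) = (1 + q + \<dots> + q\<^bsup>m-1\<^esup>) x\<^bsup>m-1\<^esup>\<close>,
  for \<open>q \<noteq> 1\<close> the power \<open>x\<^sup>m\<close> survives iff \<open>m < ord(q)\<close> (\<open>replicate_in_radical_iff\<close>).

  If \<open>ab = 1\<close>, then \<open>yx - b xy\<close> is killed by all derivations. Hence \<open>yx = b xy\<close> and the iterated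
  commutator is \<open>(b - 1)\<^sup>m x\<^sup>m y\<close>. For \<open>b \<noteq> 1\<close> it vanishes exactly when \<open>x\<^sup>m\<close> does, because
  \<open>D\<^sub>j(x\<^sup>m y) = x\<^sup>m\<close>.

  If \<open>ord(q) = r + 1\<close> and \<open>m\<^sub>i\<^sub>j = r\<close>, then \<open>x\<^bsup>r+1\<^esup> = 0\<close> while \<open>q\<^sup>k ab \<noteq> 1\<close> for \<open>k < r\<close>. The commutator
  is the alternating binomial sum of the \<open>x\<^sup>k y x\<^bsup>m-k\<^esup>\<close>, where all terms with \<open>k > r\<close> or
  \<open>m - k > r\<close> vanish. So it is \<open>0\<close> for \<open>m > 2r\<close>, and for \<open>m = 2r\<close> it is \<open>x\<^sup>r y x\<^sup>r\<close> up to a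
  nonzero integer factor. It remains to see that \<open>x\<^sup>r y x\<^sup>r \<noteq> 0\<close>. The braided commutators
  \<open>z\<^sub>0 = y\<close>, \<open>z\<^bsub>k+1\<^esub> = q\<^sup>k a z\<^sub>k x - x z\<^sub>k\<close> satisfy
  \<open>D\<^sub>i(z\<^sub>k) = 0\<close> and \<open>D\<^sub>j(z\<^sub>k) = \<Prod>\<^bsub>l<k\<^esub> (q\<^sup>l ab - 1) x\<^sup>k\<close>, and modulo \<open>x\<^bsup>r+1\<^esup>\<close> one has
  \<open>z\<^sub>r x\<^sup>r = (-1)\<^sup>r x\<^sup>r y x\<^sup>r\<close>. If this were \<open>0\<close>, applying \<open>D\<^sub>i\<close> repeatedly would strip the
  factor \<open>x\<^sup>r\<close> and give \<open>z\<^sub>r = 0\<close>, and then \<open>D\<^sub>j\<close> would give \<open>x\<^sup>r = 0\<close>, which is false.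
\<close>

section \<open>Multiplication of coefficient functions\<close>

text \<open>
  The product of \<open>tensor_algebra\<close>, on arbitrary functions: it is defined, associative and
  bilinear for infinite supports as well, so that finite supports enter only when the quotient
  ring is formed.
\<close>

definition conv :: "(nat list \<Rightarrow> 'f::field) \<Rightarrow> (nat list \<Rightarrow> 'f) \<Rightarrow> nat list \<Rightarrow> 'f"
    (infixl "\<star>" 70)
  where "u \<star> v = (\<lambda>w. \<Sum>k\<le>length w. u (take k w) * v (drop k w))"

definition smul :: "'f::field \<Rightarrow> (nat list \<Rightarrow> 'f) \<Rightarrow> nat list \<Rightarrow> 'f" (infixr "\<cdot>" 75)
  where "c \<cdot> u = (\<lambda>w. c * u w)"

lemma smul_apply [simp]: "(c \<cdot> u) w = c * u w"
  by (simp add: smul_def)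

text \<open>
  Identities between coefficient functions are proved either pointwise or in the algebra. For the
  second kind the evaluation rules are switched off: they would also fire below the abstraction
  of a function that induction has left in eta-expanded form.
\<close>

lemmas pointwise = smul_apply plus_fun_apply minus_apply zero_fun_apply

lemma smul_one [simp]: "1 \<cdot> u = u" and smul_zero [simp]: "0 \<cdot> u = 0" "c \<cdot> 0 = 0"
  and smul_smul [simp]: "c \<cdot> d \<cdot> u = (c * d) \<cdot> u"
  by (simp_all add: fun_eq_iff)

lemma conv_Nil [simp]: "(u \<star> v) [] = u [] * v []"
  by (simp add: conv_def)

text \<open>
  The recursion on the first letter of the argument makes identities for products and
  derivations provable by induction on the word at which both sides are evaluated.
\<close>

lemma conv_Cons [simp]:
  "(u \<star> v) (c # w) = u [] * v (c # w) + ((\<lambda>s. u (c # s)) \<star> v) w"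
  by (simp add: conv_def sum.atMost_Suc_shift del: sum.atMost_Suc)

lemma conv_linear_left:
  "(u + u') \<star> v = u \<star> v + u' \<star> v" "(u - u') \<star> v = u \<star> v - u' \<star> v"
  "(c \<cdot> u) \<star> v = c \<cdot> (u \<star> v)" "0 \<star> v = 0"
  by (simp_all add: fun_eq_iff conv_def algebra_simps sum.distrib sum_subtractf sum_distrib_left)

lemma conv_linear_right:
  "u \<star> (v + v') = u \<star> v + u \<star> v'" "u \<star> (v - v') = u \<star> v - u \<star> v'"
  "u \<star> (c \<cdot> v) = c \<cdot> (u \<star> v)" "u \<star> 0 = 0"
  by (simp_all add: fun_eq_iff conv_def algebra_simps sum.distrib sum_subtractf sum_distrib_left)

lemmas conv_linear = conv_linear_left conv_linear_right

lemma conv_assoc: "(u \<star> v) \<star> t = u \<star> (v \<star> t)"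
proof
  fix w show "((u \<star> v) \<star> t) w = (u \<star> (v \<star> t)) w"
  proof (induction w arbitrary: u)
    case (Cons c w)
    have "(\<lambda>s. (u \<star> v) (c # s)) = u [] \<cdot> (\<lambda>s. v (c # s)) + (\<lambda>s. u (c # s)) \<star> v"
      by (simp add: fun_eq_iff)
    then show ?case
      using Cons by (simp add: conv_linear algebra_simps)
  qed simp
qed

lemma word_vec_Nil_conv [simp]: "word_vec [] \<star> u = u"
proof
  fix w
  have "(\<lambda>s. word_vec [] (c # s) :: 'a) = 0" for c :: nat
    by (simp add: fun_eq_iff word_vec_def)
  then show "(word_vec [] \<star> u) w = u w"
    by (cases w) (simp_all add: conv_linear, simp_all add: word_vec_def)
qed

lemma conv_word_vec_Nil [simp]: "u \<star> word_vec [] = u"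
proof
  fix w show "(u \<star> word_vec []) w = u w"
  proof (induction w arbitrary: u)
    case (Cons c w)
    then show ?case by (simp add: word_vec_def)
  qed (simp add: word_vec_def)
qed

lemma conv_word_vec: "word_vec v \<star> word_vec w = word_vec (v @ w)"
proof (induction v)
  case (Cons c v)
  have tl: "(\<lambda>s. word_vec (c # v) (d # s) :: 'a) = (if c = d then word_vec v else 0)" for d
    by (auto simp: fun_eq_iff word_vec_def)
  show ?case
  proof
    fix s show "(word_vec (c # v) \<star> word_vec w) s = (word_vec ((c # v) @ w) s :: 'a)"
      using Cons by (cases s) (auto simp: tl conv_linear, auto simp: word_vec_def)
  qed
qed simp

lemma smul_diff_left: "(c - d) \<cdot> u = c \<cdot> u - d \<cdot> u"
  and smul_diff_right: "c \<cdot> (u - v) = c \<cdot> u - c \<cdot> v"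
  and smul_add_left: "(c + d) \<cdot> u = c \<cdot> u + d \<cdot> u"
  by (simp_all add: fun_eq_iff algebra_simps)

lemma conv_sum:
  "sum f A \<star> v = (\<Sum>k\<in>A. f k \<star> v)" "v \<star> sum f A = (\<Sum>k\<in>A. v \<star> f k)"
  by (induction A rule: infinite_finite_induct) (simp_all add: conv_linear)

section \<open>Skew derivations\<close>

definition braiding_scalar :: "(nat \<Rightarrow> nat \<Rightarrow> 'f::field) \<Rightarrow> nat \<Rightarrow> nat list \<Rightarrow> 'f" where
  "braiding_scalar p i w = prod_list (map (p i) w)"

text \<open>
  On basis words, \<open>skew_der p i\<close> sends \<open>w\<close> to the sum, over the occurrences \<open>w = s i t\<close> of the
  letter \<open>i\<close>, of \<open>s t\<close> times the scalar picked up when \<open>x\<^sub>i\<close> is braided past \<open>t\<close>. The equations give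
  the coefficients of the image; they insert \<open>i\<close> at every position of the argument.
\<close>

fun skew_der ::
    "(nat \<Rightarrow> nat \<Rightarrow> 'f::field) \<Rightarrow> nat \<Rightarrow> (nat list \<Rightarrow> 'f) \<Rightarrow> nat list \<Rightarrow> 'f" where
  "skew_der p i u [] = u [i]"
| "skew_der p i u (c # w) = braiding_scalar p i (c # w) * u (i # c # w) + skew_der p i (\<lambda>s. u (c # s)) w"

text \<open>
  The diagonal algebra automorphism that braiding with \<open>x\<^sub>i\<close> induces.
\<close>

definition twist ::
    "(nat \<Rightarrow> nat \<Rightarrow> 'f::field) \<Rightarrow> nat \<Rightarrow> (nat list \<Rightarrow> 'f) \<Rightarrow> nat list \<Rightarrow> 'f" where
  "twist p i u = (\<lambda>w. braiding_scalar p i w * u w)"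

lemma skew_der_linear_apply:
  "skew_der p i (\<lambda>w. c * u w + d * v w) w = c * skew_der p i u w + d * skew_der p i v w"
  by (induction w arbitrary: u v) (auto simp: algebra_simps)

lemma skew_der_linear:
  "skew_der p i (u + v) = skew_der p i u + skew_der p i v"
  "skew_der p i (u - v) = skew_der p i u - skew_der p i v"
  "skew_der p i (c \<cdot> u) = c \<cdot> skew_der p i u"
  "skew_der p i 0 = 0"
  using skew_der_linear_apply[of p i 1 u 1 v] skew_der_linear_apply[of p i 1 u "-1" v]
    skew_der_linear_apply[of p i c u 0 u] skew_der_linear_apply[of p i 0 u 0 u]
  by (simp_all add: fun_eq_iff plus_fun_def fun_diff_def smul_def zero_fun_def)

lemma twist_conv: "twist p i (u \<star> v) = twist p i u \<star> twist p i v"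
proof -
  have "braiding_scalar p i w = braiding_scalar p i (take k w) * braiding_scalar p i (drop k w)" for k w
    unfolding braiding_scalar_def by (metis append_take_drop_id map_append prod_list.append)
  then have eq: "braiding_scalar p i w * (u (take k w) * v (drop k w))
      = braiding_scalar p i (take k w) * u (take k w) * (braiding_scalar p i (drop k w) * v (drop k w))" for k w
    by (metis (no_types, lifting) mult.assoc mult.left_commute)
  show ?thesis
    by (simp only: twist_def conv_def sum_distrib_left eq)
qed

text \<open>
  A letter taken from \<open>v\<close> does not meet \<open>u\<close> on its way to the right end; a letter taken from \<open>u\<close>
  passes all of \<open>v\<close>, which accounts for the twist.
\<close>

lemma skew_der_conv:
  "skew_der p i (u \<star> v) = u \<star> skew_der p i v + skew_der p i u \<star> twist p i v"
proof
  fix w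
  show "skew_der p i (u \<star> v) w = (u \<star> skew_der p i v + skew_der p i u \<star> twist p i v) w"
  proof (induction w arbitrary: u)
    case Nil
    then show ?case by (simp add: twist_def braiding_scalar_def)
  next
    case (Cons c w)
    have tl: "(\<lambda>s. (u \<star> v) (c # s)) = u [] \<cdot> (\<lambda>s. v (c # s)) + (\<lambda>s. u (c # s)) \<star> v"
      by (simp add: fun_eq_iff)
    have der_tl: "(\<lambda>s. skew_der p i u (c # s))
        = p i c \<cdot> twist p i (\<lambda>s. u (i # c # s)) + skew_der p i (\<lambda>s. u (c # s))"
      by (simp add: fun_eq_iff twist_def braiding_scalar_def)
    show ?case
      unfolding skew_der.simps tl
      by (simp add: skew_der_linear Cons der_tl conv_linear del: skew_der.simps flip: twist_conv)
         (simp add: twist_def braiding_scalar_def algebra_simps)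
  qed
qed

lemma twist_word_vec: "twist p i (word_vec w) = braiding_scalar p i w \<cdot> word_vec w"
  by (auto simp: fun_eq_iff twist_def word_vec_def)

lemma skew_der_word_vec_Nil: "skew_der p i (word_vec []) = 0"
proof -
  let ?d = "skew_der p i (word_vec [])"
  have "?d = ?d + ?d"
    using skew_der_conv[of p i "word_vec []" "word_vec []"]
    by (simp add: twist_word_vec braiding_scalar_def)
  then show ?thesis by (metis add_cancel_left_right)
qed

lemma skew_der_word_vec_single:
  "skew_der p i (word_vec [j]) = (if i = j then word_vec [] else 0)"
proof
  fix w
  have "(\<lambda>s. word_vec [j] (c # s) :: 'a) = (if c = j then word_vec [] else 0)" for c
    by (auto simp: fun_eq_iff word_vec_def)
  then show "skew_der p i (word_vec [j]) w = (if i = j then word_vec [] else 0) w"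
    by (cases w) (auto simp: skew_der_linear skew_der_word_vec_Nil, auto simp: word_vec_def)
qed

lemma skew_der_twist: "skew_der p i (twist p j u) = p j i \<cdot> twist p j (skew_der p i u)"
proof
  fix w
  show "skew_der p i (twist p j u) w = (p j i \<cdot> twist p j (skew_der p i u)) w"
  proof (induction w arbitrary: u)
    case Nil
    then show ?case by (simp add: twist_def braiding_scalar_def)
  next
    case (Cons c w)
    have "(\<lambda>s. twist p j u (c # s)) = p j c \<cdot> twist p j (\<lambda>s. u (c # s))"
      by (simp add: fun_eq_iff twist_def braiding_scalar_def)
    then show ?case
      by (simp add: skew_der_linear Cons) (simp add: twist_def braiding_scalar_def algebra_simps)
  qed
qed

section \<open>The ideal of elements killed by all iterated derivatives\<close>

text \<open>
  The radical of the Hopf pairing on the tensor algebra: the pairing of \<open>u\<close> with a word \<open>w\<close> is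
  obtained by differentiating with respect to the letters of \<open>w\<close>, the last one first, and taking
  the constant term.
\<close>

definition radical :: "(nat \<Rightarrow> nat \<Rightarrow> 'f::field) \<Rightarrow> (nat list \<Rightarrow> 'f) set" where
  "radical p = {u. \<forall>w. foldr (skew_der p) w u [] = 0}"

lemma radical_iff: "u \<in> radical p \<longleftrightarrow> u [] = 0 \<and> (\<forall>i. skew_der p i u \<in> radical p)"
proof -
  have "u \<in> radical p" if "u [] = 0" "\<forall>i. skew_der p i u \<in> radical p"
    unfolding radical_def
  proof (safe)
    fix w show "foldr (skew_der p) w u [] = 0"
      using that by (cases w rule: rev_cases) (auto simp: radical_def)
  qed
  moreover have "skew_der p i u \<in> radical p" if "u \<in> radical p" for i
    unfolding radical_def
  proof safe
    fix w
    from that have "foldr (skew_der p) (w @ [i]) u [] = 0"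
      unfolding radical_def by blast
    then show "foldr (skew_der p) w (skew_der p i u) [] = 0" by simp
  qed
  moreover have "u [] = 0" if "u \<in> radical p"
  proof -
    from that have "foldr (skew_der p) [] u [] = 0"
      unfolding radical_def by blast
    then show ?thesis by simp
  qed
  ultimately show ?thesis by blast
qed

lemma radical_skew_der: "u \<in> radical p \<Longrightarrow> skew_der p i u \<in> radical p"
  using radical_iff by blast

lemma radical_Nil: "u \<in> radical p \<Longrightarrow> u [] = 0"
  using radical_iff by blast

lemma foldr_skew_der_linear:
  "foldr (skew_der p) w (u + v) = foldr (skew_der p) w u + foldr (skew_der p) w v"
  "foldr (skew_der p) w (c \<cdot> u) = c \<cdot> foldr (skew_der p) w u"
  "foldr (skew_der p) w 0 = 0"
  by (induction w) (simp_all add: skew_der_linear)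

lemma radical_zero [simp]: "0 \<in> radical p"
  and radical_add: "u \<in> radical p \<Longrightarrow> v \<in> radical p \<Longrightarrow> u + v \<in> radical p"
  and radical_smul: "u \<in> radical p \<Longrightarrow> c \<cdot> u \<in> radical p"
  by (simp_all add: radical_def foldr_skew_der_linear)

lemma radical_diff: "u \<in> radical p \<Longrightarrow> v \<in> radical p \<Longrightarrow> u - v \<in> radical p"
proof -
  have "u - v = u + (-1) \<cdot> v" by (simp add: fun_eq_iff)
  then show "u \<in> radical p \<Longrightarrow> v \<in> radical p \<Longrightarrow> u - v \<in> radical p"
    by (simp only: radical_add radical_smul)
qed

lemma radical_sum: "(\<And>k. k \<in> A \<Longrightarrow> f k \<in> radical p) \<Longrightarrow> sum f A \<in> radical p"
  by (induction A rule: infinite_finite_induct) (simp_all add: radical_add)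

lemma radical_cong:
  assumes "u - v \<in> radical p"
  shows "u \<in> radical p \<longleftrightarrow> v \<in> radical p"
proof
  assume "u \<in> radical p"
  from radical_diff[OF this assms] show "v \<in> radical p" by simp
next
  assume "v \<in> radical p"
  from radical_add[OF assms this] show "u \<in> radical p" by simp
qed

lemma radical_smul_iff:
  assumes "c \<noteq> 0" shows "c \<cdot> u \<in> radical p \<longleftrightarrow> u \<in> radical p"
  using radical_smul[of "c \<cdot> u" p "inverse c"] radical_smul[of u p c] assms by auto

text \<open>
  Twists commute with skew derivations up to scalars, and they do not change whether the constant
  term vanishes.
\<close>

lemma radical_twist:
  assumes "u \<in> radical p" shows "twist p j u \<in> radical p"
proof -
  have "foldr (skew_der p) w (twist p j u) = braiding_scalar p j w \<cdot> twist p j (foldr (skew_der p) w u)" for w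
  proof (induction w)
    case (Cons i w)
    then show ?case
      by (simp only: foldr.simps o_apply skew_der_linear skew_der_twist)
         (simp add: fun_eq_iff braiding_scalar_def)
  qed (simp add: fun_eq_iff braiding_scalar_def)
  then show ?thesis
    using assms by (simp add: radical_def twist_def)
qed

text \<open>
  By the product rule every derivative of \<open>u \<star> v\<close> is a sum of two products of the same kind with
  a factor in the radical, so induction on the number of derivations applies. The same argument
  works for \<open>radical_conv_left\<close>, where the twisted factor is covered by \<open>radical_twist\<close>.
\<close>

lemma radical_conv_right:
  assumes "u \<in> radical p" shows "u \<star> v \<in> radical p"
proof -
  have "foldr (skew_der p) w (u \<star> v) [] = 0" if "u \<in> radical p" for w u v
    using that
    by (induction w arbitrary: u v rule: rev_induct)
       (simp_all add: radical_Nil radical_skew_der skew_der_conv foldr_skew_der_linear)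
  then show ?thesis using assms by (simp add: radical_def)
qed

lemma radical_conv_left:
  assumes "v \<in> radical p" shows "u \<star> v \<in> radical p"
proof -
  have "foldr (skew_der p) w (u \<star> v) [] = 0" if "v \<in> radical p" for w u v
    using that
    by (induction w arbitrary: u v rule: rev_induct)
       (simp_all add: radical_Nil radical_skew_der radical_twist skew_der_conv
          foldr_skew_der_linear)
  then show ?thesis using assms by (simp add: radical_def)
qed

section \<open>The Nichols ideal as a radical\<close>

lemma skew_der_snoc:
  "skew_der p i u (v @ [j]) = u (v @ [j, i]) + p i j * skew_der p i (\<lambda>s. u (s @ [j])) v"
  by (induction v arbitrary: u) (simp_all add: braiding_scalar_def algebra_simps)

text \<open>
  The braided integer moves each letter of a word to the last position in all possible ways, so
  its coefficients with last letter \<open>i\<close> are those of the derivative with respect to \<open>i\<close>. The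
  suffix \<open>r\<close> is not touched; it has to be arbitrary because the recursion for the braided
  integer shortens the relevant prefix of a word of fixed length.
\<close>

lemma braided_int_eq_skew_der:
  assumes "length v = m"
  shows "braided_int p (Suc m) u (v @ i # r) = skew_der p i (\<lambda>s. u (s @ r)) v"
  using assms
proof (induction m arbitrary: v i r)
  case (Suc m)
  obtain v' j where v: "v = v' @ [j]" and m: "length v' = m"
    using Suc.prems by (metis length_Suc_conv_rev)
  have upd: "(v' @ j # i # r)[m := i, Suc m := j] = v' @ i # j # r"
    using m by (simp add: list_update_append)
  have "braided_int p (Suc (Suc m)) u (v @ i # r)
      = u (v' @ j # i # r) + p i j * braided_int p (Suc m) u (v' @ i # j # r)"
    using m by (simp add: v braid_at_def nth_append upd)
  then show ?case
    using Suc.IH[OF m] by (simp add: v skew_der_snoc)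
qed simp

lemma skew_der_local:
  assumes "\<And>s. length s = Suc (length v) \<Longrightarrow> u s = u' s"
  shows "skew_der p i u v = skew_der p i u' v"
  using assms
proof (induction v arbitrary: u u')
  case (Cons c v)
  from Cons.IH[of "\<lambda>s. u (c # s)" "\<lambda>s. u' (c # s)"] Cons.prems show ?case by simp
qed simp

lemma foldr_skew_der_local:
  assumes "\<And>s. length s = length v \<Longrightarrow> u s = u' s"
  shows "foldr (skew_der p) v u [] = foldr (skew_der p) v u' []"
  using assms
proof (induction v arbitrary: u u' rule: rev_induct)
  case (snoc i v)
  show ?case
    using snoc.IH[of "skew_der p i u" "skew_der p i u'"] snoc.prems
    by (simp add: skew_der_local[of _ u u'])
qed simp

text \<open>
  The recursion of the quantum symmetrizer peels off the last letter through one braided integer,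
  that is, through one skew derivation.
\<close>

lemma quantum_symmetrizer_eq_foldr_skew_der:
  assumes "length v = m"
  shows "quantum_symmetrizer p m u (v @ r) = foldr (skew_der p) v (\<lambda>s. u (s @ r)) []"
  using assms
proof (induction m arbitrary: u v r)
  case (Suc m)
  obtain v' i where v: "v = v' @ [i]" and m: "length v' = m"
    using Suc.prems by (metis length_Suc_conv_rev)
  have "quantum_symmetrizer p (Suc m) u (v @ r)
      = foldr (skew_der p) v' (\<lambda>s. braided_int p (Suc m) u (s @ i # r)) []"
    using Suc.IH[OF m, of "braided_int p (Suc m) u" "i # r"] by (simp add: v)
  also have "\<dots> = foldr (skew_der p) v' (skew_der p i (\<lambda>s. u (s @ r))) []"
    by (rule foldr_skew_der_local) (simp add: braided_int_eq_skew_der m)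
  finally show ?case by (simp add: v)
qed simp

lemma nichols_ideal_eq_radical:
  "nichols_ideal n p = carrier (tensor_algebra n) \<inter> radical p"
proof -
  have "quantum_symmetrizer p (length w) (degree_part (length w) u) w = foldr (skew_der p) w u []"
    for u :: "nat list \<Rightarrow> 'a" and w
    using quantum_symmetrizer_eq_foldr_skew_der[of w "length w" p "degree_part (length w) u" "[]"]
      foldr_skew_der_local[of w "degree_part (length w) u" u p]
    by (simp add: degree_part_def)
  then show ?thesis
    by (auto simp: nichols_ideal_def radical_def)
qed


section \<open>The quotient ring\<close>

lemma word_vec_mem_tensor_algebra [intro]:
  "set w \<subseteq> {1..n} \<Longrightarrow> word_vec w \<in> carrier (tensor_algebra n)"
  by (auto simp: tensor_algebra_def word_vec_def)

lemma tensor_algebra_conv_closed: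
  assumes "u \<in> carrier (tensor_algebra n)" "v \<in> carrier (tensor_algebra n)"
  shows "u \<star> v \<in> carrier (tensor_algebra n)"
proof -
  have split: "\<exists>s t. w = s @ t \<and> u s \<noteq> 0 \<and> v t \<noteq> 0" if "(u \<star> v) w \<noteq> 0" for w
  proof -
    from that obtain k where "u (take k w) * v (drop k w) \<noteq> 0"
      unfolding conv_def by (meson sum.not_neutral_contains_not_neutral)
    then show ?thesis
      by (metis append_take_drop_id mult_zero_left mult_zero_right)
  qed
  have "{w. (u \<star> v) w \<noteq> 0} \<subseteq> (\<lambda>(s, t). s @ t) ` ({s. u s \<noteq> 0} \<times> {t. v t \<noteq> 0})"
    using split by fast
  then have "finite {w. (u \<star> v) w \<noteq> 0}"
    using assms by (elim finite_subset) (simp add: tensor_algebra_def)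
  moreover have "set w \<subseteq> {1..n}" if "(u \<star> v) w \<noteq> 0" for w
    using split[OF that] assms unfolding tensor_algebra_def by fastforce
  ultimately show ?thesis by (simp add: tensor_algebra_def)
qed

lemma tensor_algebra_add_closed:
  assumes "u \<in> carrier (tensor_algebra n)" "v \<in> carrier (tensor_algebra n)"
  shows "u + v \<in> carrier (tensor_algebra n)"
proof -
  have "{w. (u + v) w \<noteq> 0} \<subseteq> {w. u w \<noteq> 0} \<union> {w. v w \<noteq> 0}" by auto
  then have "finite {w. (u + v) w \<noteq> 0}"
    using assms by (elim finite_subset) (simp add: tensor_algebra_def)
  moreover have "set w \<subseteq> {1..n}" if "(u + v) w \<noteq> 0" for w
  proof -
    from that have "u w \<noteq> 0 \<or> v w \<noteq> 0" by auto
    then show ?thesis using assms by (auto simp: tensor_algebra_def)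
  qed
  ultimately show ?thesis by (simp add: tensor_algebra_def)
qed

lemma tensor_algebra_uminus_closed:
  "u \<in> carrier (tensor_algebra n) \<Longrightarrow> - u \<in> carrier (tensor_algebra n)"
  by (simp add: tensor_algebra_def)

lemma tensor_algebra_ops:
  "u \<otimes>\<^bsub>tensor_algebra n\<^esub> v = u \<star> v" "u \<oplus>\<^bsub>tensor_algebra n\<^esub> v = u + v"
  "\<one>\<^bsub>tensor_algebra n\<^esub> = word_vec []" "\<zero>\<^bsub>tensor_algebra n\<^esub> = 0"
  by (simp_all add: tensor_algebra_def conv_def plus_fun_def word_vec_def zero_fun_def)

lemma ring_tensor_algebra: "ring (tensor_algebra n :: (nat list \<Rightarrow> 'a::field) ring)"
proof (rule ringI)
  show "abelian_group (tensor_algebra n :: (nat list \<Rightarrow> 'a) ring)"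
  proof (rule abelian_groupI)
    show "\<exists>v\<in>carrier (tensor_algebra n). v \<oplus>\<^bsub>tensor_algebra n\<^esub> u = \<zero>\<^bsub>tensor_algebra n\<^esub>"
      if "u \<in> carrier (tensor_algebra n)" for u :: "nat list \<Rightarrow> 'a"
      using tensor_algebra_uminus_closed[OF that] by (force simp: tensor_algebra_ops)
    show "\<zero>\<^bsub>tensor_algebra n\<^esub> \<in> carrier (tensor_algebra n :: (nat list \<Rightarrow> 'a) ring)"
      by (simp add: tensor_algebra_def)
  qed (simp_all add: tensor_algebra_ops tensor_algebra_add_closed add.assoc add.commute)
  show "monoid (tensor_algebra n :: (nat list \<Rightarrow> 'a) ring)"
    by (rule monoidI)
      (auto simp: tensor_algebra_ops tensor_algebra_conv_closed conv_assoc)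
qed (simp_all add: tensor_algebra_ops conv_linear)

lemma tensor_algebra_a_inv:
  assumes "u \<in> carrier (tensor_algebra n)"
  shows "\<ominus>\<^bsub>tensor_algebra n\<^esub> u = - u"
proof -
  interpret ring "tensor_algebra n" by (rule ring_tensor_algebra)
  show ?thesis
    by (rule minus_equality) (simp_all add: tensor_algebra_ops assms tensor_algebra_uminus_closed)
qed

lemma nichols_ideal_is_ideal: "ideal (nichols_ideal n p) (tensor_algebra n)"
proof -
  interpret ring "tensor_algebra n" by (rule ring_tensor_algebra)
  have neg: "- u \<in> radical p" if "u \<in> radical p" for u
    using radical_diff[OF radical_zero that] by simp
  have zero: "0 \<in> carrier (tensor_algebra n)"
    using zero_closed by (simp add: tensor_algebra_ops)
  have "subgroup (nichols_ideal n p) (add_monoid (tensor_algebra n))"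
    unfolding nichols_ideal_eq_radical
  proof (rule add.subgroupI)
    show "carrier (tensor_algebra n) \<inter> radical p \<noteq> {}"
      using zero radical_zero by blast
  qed (auto simp: tensor_algebra_ops tensor_algebra_a_inv radical_add neg
      tensor_algebra_add_closed tensor_algebra_uminus_closed)
  then show ?thesis
    by (intro idealI ring_tensor_algebra)
       (auto simp: nichols_ideal_eq_radical tensor_algebra_ops tensor_algebra_conv_closed
          radical_conv_left radical_conv_right)
qed

primrec lifted_comm :: "nat \<Rightarrow> nat \<Rightarrow> nat \<Rightarrow> nat list \<Rightarrow> 'f::field" where
  "lifted_comm i j 0 = word_vec [j]"
| "lifted_comm i j (Suc m) = lifted_comm i j m \<star> word_vec [i] - word_vec [i] \<star> lifted_comm i j m"

lemma iter_comm_eq_coset: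
  fixes p :: "nat \<Rightarrow> nat \<Rightarrow> 'f::field"
  assumes "i \<in> {1..n}" "j \<in> {1..n}"
  shows "iter_comm n p i j m = nichols_ideal n p +>\<^bsub>tensor_algebra n\<^esub> lifted_comm i j m"
    and "lifted_comm i j m \<in> carrier (tensor_algebra n :: (nat list \<Rightarrow> 'f) ring)"
proof -
  let ?T = "tensor_algebra n :: (nat list \<Rightarrow> 'f) ring" and ?I = "nichols_ideal n p"
  interpret ideal ?I ?T by (rule nichols_ideal_is_ideal)
  interpret quot: ring_hom_ring ?T "nichols_algebra n p" "(+>\<^bsub>?T\<^esub>) ?I"
    unfolding nichols_algebra_def by (rule rcos_ring_hom_ring)
  have x: "word_vec [i] \<in> carrier ?T" and y: "word_vec [j] \<in> carrier ?T"
    using assms by auto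
  have *: "iter_comm n p i j m = ?I +>\<^bsub>?T\<^esub> lifted_comm i j m \<and> lifted_comm i j m \<in> carrier ?T"
  proof (induction m)
    case (Suc m)
    let ?l = "lifted_comm i j m :: nat list \<Rightarrow> 'f" and ?x = "word_vec [i] :: nat list \<Rightarrow> 'f"
    have l: "?l \<in> carrier ?T" using Suc by blast
    have "lifted_comm i j (Suc m) = ?l \<otimes>\<^bsub>?T\<^esub> ?x \<ominus>\<^bsub>?T\<^esub> ?x \<otimes>\<^bsub>?T\<^esub> ?l"
      using l x by (simp add: tensor_algebra_ops a_minus_def tensor_algebra_a_inv
          tensor_algebra_conv_closed)
    then show ?case
      using Suc x by (simp add: comm_minus_def nichols_gen_def a_minus_def)
  qed (simp add: nichols_gen_def y)
  then show "iter_comm n p i j m = ?I +>\<^bsub>?T\<^esub> lifted_comm i j m" "lifted_comm i j m \<in> carrier ?T"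
    by blast+
qed

lemma iter_comm_eq_zero_iff:
  assumes "i \<in> {1..n}" "j \<in> {1..n}"
  shows "iter_comm n p i j m = \<zero>\<^bsub>nichols_algebra n p\<^esub> \<longleftrightarrow> lifted_comm i j m \<in> radical p"
proof -
  interpret ideal "nichols_ideal n p" "tensor_algebra n" by (rule nichols_ideal_is_ideal)
  note l = iter_comm_eq_coset[OF assms]
  have "\<zero>\<^bsub>nichols_algebra n p\<^esub> = nichols_ideal n p"
    by (simp add: nichols_algebra_def FactRing_def)
  moreover have "nichols_ideal n p +>\<^bsub>tensor_algebra n\<^esub> lifted_comm i j m = nichols_ideal n p
      \<longleftrightarrow> lifted_comm i j m \<in> nichols_ideal n p"
    using rcos_const_imp_mem[OF l(2)] a_rcos_zero[OF nichols_ideal_is_ideal] by blast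
  ultimately show ?thesis
    using l(2) unfolding l(1) nichols_ideal_eq_radical by blast
qed


section \<open>Powers of a generator\<close>

text \<open>
  The scalar is the \<open>q\<close>-integer \<open>m\<^sub>q\<close> for \<open>q = p\<^sub>i\<^sub>i\<close>; at \<open>m = 0\<close> it is the empty sum.
\<close>

lemma skew_der_replicate:
  "skew_der p k (word_vec (replicate m i)) =
    (if k = i then (\<Sum>l<m. p i i ^ l) \<cdot> word_vec (replicate (m - 1) i) else 0)"
proof (induction m)
  case (Suc m)
  have "word_vec (replicate (Suc m) i) = word_vec (replicate m i) \<star> (word_vec [i] :: nat list \<Rightarrow> 'a)"
    by (simp add: conv_word_vec replicate_append_same)
  then have der: "skew_der p k (word_vec (replicate (Suc m) i)) =
      (if k = i then word_vec (replicate m i) else 0)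
      + p k i \<cdot> (skew_der p k (word_vec (replicate m i)) \<star> word_vec [i])"
    by (simp add: skew_der_conv skew_der_word_vec_single twist_word_vec braiding_scalar_def conv_linear)
  show ?case
  proof (cases "k = i")
    case True
    have "(\<Sum>l<m. p i i ^ l) \<cdot> word_vec (replicate (m - 1) i) \<star> word_vec [i]
        = (\<Sum>l<m. p i i ^ l) \<cdot> (word_vec (replicate m i) :: nat list \<Rightarrow> 'a)"
      by (cases m) (simp_all add: conv_linear conv_word_vec replicate_append_same)
    then show ?thesis
      unfolding der Suc using True
      by (simp add: sum.lessThan_Suc_shift sum_distrib_left smul_add_left del: sum.lessThan_Suc)
  next
    case False
    then show ?thesis unfolding der Suc by (simp add: conv_linear)
  qed
qed (simp add: skew_der_word_vec_Nil)

lemma replicate_Suc_in_radical_iff: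
  "word_vec (replicate (Suc m) i) \<in> radical p \<longleftrightarrow>
    (\<Sum>l\<le>m. p i i ^ l) = 0 \<or> word_vec (replicate m i) \<in> radical p"
proof -
  let ?c = "\<Sum>l<Suc m. p i i ^ l"
  have "word_vec (replicate (Suc m) i) [] = (0 :: 'a)"
    by (simp add: word_vec_def)
  then have "word_vec (replicate (Suc m) i) \<in> radical p \<longleftrightarrow>
      ?c \<cdot> word_vec (replicate m i) \<in> radical p"
    using skew_der_replicate[of p _ "Suc m" i] radical_iff[of "word_vec (replicate (Suc m) i)" p]
    by (auto simp del: replicate.simps sum.lessThan_Suc split: if_splits)
  then show ?thesis
    by (cases "?c = 0") (simp_all add: radical_smul_iff flip: lessThan_Suc_atMost)
qed

lemma word_vec_Nil_not_in_radical: "word_vec [] \<notin> radical p"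
  using radical_Nil[of "word_vec []" p] by (auto simp: word_vec_def)

lemma enat_less_mult_ord_iff: "enat m < mult_ord q \<longleftrightarrow> (\<forall>k\<in>{1..m}. q ^ k \<noteq> 1)"
proof (cases "\<exists>k>0. q ^ k = 1")
  case True
  define N where "N = (LEAST k. k > 0 \<and> q ^ k = 1)"
  have N: "N > 0 \<and> q ^ N = 1"
    unfolding N_def using True by (rule LeastI_ex)
  have least: "N \<le> k" if "k > 0" "q ^ k = 1" for k
    unfolding N_def using that by (intro Least_le conjI)
  have "mult_ord q = enat N" using True by (simp add: mult_ord_def N_def)
  moreover have "m < N \<longleftrightarrow> (\<forall>k\<in>{1..m}. q ^ k \<noteq> 1)"
    using N least by (metis One_nat_def Suc_leI atLeastAtMost_iff le_less_trans
        less_irrefl not_le_imp_less order_less_le_trans zero_less_one)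
  ultimately show ?thesis by simp
next
  case False
  then have "\<forall>k\<in>{1..m}. q ^ k \<noteq> 1"
    by (metis One_nat_def Suc_le_eq atLeastAtMost_iff)
  moreover have "mult_ord q = \<infinity>" using False by (simp only: mult_ord_def if_False)
  ultimately show ?thesis by simp
qed

text \<open>
  By \<open>replicate_Suc_in_radical_iff\<close> the power vanishes as soon as one of the \<open>q\<close>-integers up to
  \<open>m\<close> does, and for \<open>q \<noteq> 1\<close> the \<open>q\<close>-integer of \<open>k\<close> is \<open>(q\<^sup>k - 1) / (q - 1)\<close>.
\<close>

lemma replicate_in_radical_iff:
  assumes "p i i \<noteq> 1"
  shows "word_vec (replicate m i) \<in> radical p \<longleftrightarrow> \<not> enat m < mult_ord (p i i)"
proof (induction m)
  case (Suc m)
  have "(\<Sum>l\<le>m. p i i ^ l) = 0 \<longleftrightarrow> p i i ^ Suc m = 1"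
    using assms sum_gp_basic[of "p i i" m] by auto
  then show ?case
    unfolding replicate_Suc_in_radical_iff Suc enat_less_mult_ord_iff
    by (simp only: atLeastAtMostSuc_conv le_add1 plus_1_eq_Suc) auto
qed (simp add: word_vec_Nil_not_in_radical enat_less_mult_ord_iff)

section \<open>Letters with trivial mutual braiding\<close>

text \<open>
  The derivative with respect to \<open>i\<close> is \<open>(1 - p\<^sub>i\<^sub>j p\<^sub>j\<^sub>i) x\<^sub>j\<close>, and the one with respect to \<open>j\<close> is
  \<open>p\<^sub>j\<^sub>i x\<^sub>i - p\<^sub>j\<^sub>i x\<^sub>i\<close>.
\<close>

lemma quantum_plane_relation:
  assumes "i \<noteq> j" "p i j * p j i = 1"
  shows "word_vec [j, i] - p j i \<cdot> word_vec [i, j] \<in> radical p"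
proof -
  have words: "word_vec [a, b] = word_vec [a] \<star> (word_vec [b] :: nat list \<Rightarrow> 'a)" for a b
    by (simp add: conv_word_vec)
  have "skew_der p k (word_vec [j, i] - p j i \<cdot> word_vec [i, j]) = 0" for k
    using assms
    by (simp add: words skew_der_linear skew_der_conv skew_der_word_vec_single twist_word_vec
        braiding_scalar_def conv_linear mult.commute)
  then show ?thesis
    by (subst radical_iff) (simp add: word_vec_def)
qed

text \<open>
  Pushing \<open>x\<^sub>j\<close> through one \<open>x\<^sub>i\<close> costs \<open>p\<^sub>j\<^sub>i\<close>, so each commutator multiplies by \<open>p\<^sub>j\<^sub>i - 1\<close>.
\<close>

lemma lifted_comm_quantum_plane:
  assumes "i \<noteq> j" "p i j * p j i = 1"
  shows "lifted_comm i j m - (p j i - 1) ^ m \<cdot> word_vec (replicate m i @ [j]) \<in> radical p"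
proof (induction m)
  case (Suc m)
  let ?x = "word_vec [i] :: nat list \<Rightarrow> 'a"
  let ?c = "(p j i - 1) ^ m" and ?xm = "word_vec (replicate m i) :: nat list \<Rightarrow> 'a"
  let ?rel = "word_vec [j, i] - p j i \<cdot> word_vec [i, j]"
  let ?d = "lifted_comm i j m - ?c \<cdot> word_vec (replicate m i @ [j])"
  have "lifted_comm i j (Suc m) - (p j i - 1) ^ Suc m \<cdot> word_vec (replicate (Suc m) i @ [j])
      = ?d \<star> ?x - ?x \<star> ?d + ?c \<cdot> (?xm \<star> ?rel)"
    by (simp add: conv_linear conv_word_vec replicate_app_Cons_same)
       (simp add: fun_eq_iff algebra_simps)
  moreover have "?d \<star> ?x - ?x \<star> ?d + ?c \<cdot> (?xm \<star> ?rel) \<in> radical p"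
    by (intro radical_add radical_diff radical_smul radical_conv_right[OF Suc]
        radical_conv_left[OF Suc] radical_conv_left quantum_plane_relation assms)
  ultimately show ?case by (simp only:)
qed (simp del: pointwise)

lemma replicate_append_in_radical_iff:
  assumes "i \<noteq> j"
  shows "word_vec (replicate m i @ [j]) \<in> radical p \<longleftrightarrow> word_vec (replicate m i) \<in> radical p"
proof
  have eq: "word_vec (replicate m i @ [j]) = word_vec (replicate m i) \<star> (word_vec [j] :: nat list \<Rightarrow> 'a)"
    by (simp add: conv_word_vec)
  have "skew_der p j (word_vec (replicate m i @ [j])) = word_vec (replicate m i)"
    using assms by (simp add: eq skew_der_conv skew_der_word_vec_single skew_der_replicate conv_linear)
  then show "word_vec (replicate m i) \<in> radical p" if "word_vec (replicate m i @ [j]) \<in> radical p"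
    using radical_skew_der[OF that, of j] by simp
  show "word_vec (replicate m i @ [j]) \<in> radical p" if "word_vec (replicate m i) \<in> radical p"
    unfolding eq using that by (rule radical_conv_right)
qed

lemma lifted_comm_in_radical_iff_quantum_plane:
  assumes "i \<noteq> j" "p i j * p j i = 1" "p j i \<noteq> 1" "p i i \<noteq> 1"
  shows "lifted_comm i j m \<in> radical p \<longleftrightarrow> \<not> enat m < mult_ord (p i i)"
  using radical_cong[OF lifted_comm_quantum_plane[OF assms(1,2), of m]] assms
  by (simp add: radical_smul_iff replicate_append_in_radical_iff replicate_in_radical_iff)

section \<open>A generator with a vanishing power\<close>

text \<open>
  As \<open>u\<close> is a constant for the derivation \<open>D\<^sub>i\<close>, each application of \<open>D\<^sub>i\<close> removes one factor \<open>x\<^sub>i\<close> from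
  \<open>u x\<^sub>i\<^sup>m\<close> at the cost of a \<open>q\<close>-integer, and these are nonzero when \<open>x\<^sub>i\<^sup>m\<close> is not in the radical.
\<close>

lemma radical_cancel_replicate:
  assumes "u \<star> word_vec (replicate m i) \<in> radical p" "skew_der p i u = 0"
    and "word_vec (replicate m i) \<notin> radical p"
  shows "u \<in> radical p"
  using assms
proof (induction m)
  case (Suc m)
  let ?c = "\<Sum>l\<le>m. p i i ^ l"
  have c: "?c \<noteq> 0" and xm: "word_vec (replicate m i) \<notin> radical p"
    using Suc.prems(3) unfolding replicate_Suc_in_radical_iff by blast+
  have "skew_der p i (u \<star> word_vec (replicate (Suc m) i)) = ?c \<cdot> (u \<star> word_vec (replicate m i))"
    using Suc.prems(2)
    by (simp add: skew_der_conv skew_der_replicate conv_linear lessThan_Suc_atMost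
        del: pointwise replicate.simps sum.lessThan_Suc)
  then have "u \<star> word_vec (replicate m i) \<in> radical p"
    using radical_skew_der[OF Suc.prems(1), of i] c by (simp add: radical_smul_iff)
  then show ?case using Suc.IH Suc.prems(2) xm by blast
qed simp

text \<open>
  Up to the sign \<open>(-1)\<^sup>k\<close> this is the iterated braided commutator \<open>ad\<^sub>c(x\<^sub>i)\<^sup>k(x\<^sub>j)\<close>: the scalar
  \<open>p\<^sub>i\<^sub>i\<^sup>k p\<^sub>i\<^sub>j\<close> is the one by which \<open>x\<^sub>i\<close> braids past the \<open>k\<close>-th commutator.
\<close>

primrec braided_ad ::
    "(nat \<Rightarrow> nat \<Rightarrow> 'f::field) \<Rightarrow> nat \<Rightarrow> nat \<Rightarrow> nat \<Rightarrow> nat list \<Rightarrow> 'f" where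
  "braided_ad p i j 0 = word_vec [j]"
| "braided_ad p i j (Suc k) =
    (p i i ^ k * p i j) \<cdot> (braided_ad p i j k \<star> word_vec [i]) - word_vec [i] \<star> braided_ad p i j k"

lemma twist_linear:
  "twist p i (u - v) = twist p i u - twist p i v" "twist p i (c \<cdot> u) = c \<cdot> twist p i u"
  by (simp_all add: fun_eq_iff twist_def algebra_simps)

lemma twist_braided_ad: "twist p i (braided_ad p i j k) = (p i i ^ k * p i j) \<cdot> braided_ad p i j k"
proof (induction k)
  case (Suc k)
  show ?case
    by (simp only: braided_ad.simps twist_linear twist_conv Suc twist_word_vec)
       (simp add: conv_linear braiding_scalar_def smul_diff_right mult_ac del: pointwise)
qed (simp add: twist_word_vec braiding_scalar_def)

text \<open>
  The two summands of the next commutator contribute the same multiple of the present one, by the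
  choice of the scalar.
\<close>

lemma skew_der_braided_ad_same:
  assumes "i \<noteq> j" shows "skew_der p i (braided_ad p i j k) = 0"
proof (induction k)
  case (Suc k)
  then show ?case
    by (simp add: skew_der_linear skew_der_conv skew_der_word_vec_single twist_braided_ad conv_linear
        del: pointwise)
qed (simp add: skew_der_word_vec_single assms del: pointwise)

lemma skew_der_braided_ad_other:
  assumes "i \<noteq> j"
  shows "skew_der p j (braided_ad p i j k)
    = (\<Prod>l<k. p i i ^ l * p i j * p j i - 1) \<cdot> word_vec (replicate k i)"
proof (induction k)
  case (Suc k)
  show ?case
    using assms
    by (simp add: skew_der_linear skew_der_conv skew_der_word_vec_single twist_word_vec Suc
        conv_linear conv_word_vec braiding_scalar_def replicate_append_same del: pointwise)
       (simp add: fun_eq_iff algebra_simps)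
qed (simp add: skew_der_word_vec_single del: pointwise)

definition sandwich :: "nat \<Rightarrow> nat \<Rightarrow> nat \<Rightarrow> nat \<Rightarrow> nat list \<Rightarrow> 'f::field" where
  "sandwich i j k l = word_vec (replicate k i @ j # replicate l i)"

lemma sandwich_conv: "sandwich i j k l \<star> word_vec [i] = sandwich i j k (Suc l)"
  and conv_sandwich: "word_vec [i] \<star> sandwich i j k l = sandwich i j (Suc k) l"
  by (simp_all add: sandwich_def conv_word_vec replicate_append_same)

text \<open>
  In \<open>z\<^bsub>k+1\<^esub> x\<^sub>i\<^sup>r\<close> the summand \<open>z\<^sub>k x\<^sub>i x\<^sub>i\<^sup>r\<close> lies in the radical, so only \<open>- x\<^sub>i z\<^sub>k x\<^sub>i\<^sup>r\<close> remains.
\<close>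

lemma braided_ad_conv_replicate:
  assumes "word_vec (replicate (Suc r) i) \<in> radical p"
  shows "braided_ad p i j k \<star> word_vec (replicate r i) - (-1) ^ k \<cdot> sandwich i j k r \<in> radical p"
proof (induction k)
  case (Suc k)
  let ?x = "word_vec [i] :: nat list \<Rightarrow> 'a" and ?z = "braided_ad p i j k"
  have "braided_ad p i j (Suc k) \<star> word_vec (replicate r i) - (-1) ^ Suc k \<cdot> sandwich i j (Suc k) r
      = (p i i ^ k * p i j) \<cdot> (?z \<star> word_vec (replicate (Suc r) i))
        - ?x \<star> (?z \<star> word_vec (replicate r i) - (-1) ^ k \<cdot> sandwich i j k r)"
    by (simp add: conv_linear conv_assoc conv_word_vec conv_sandwich)
       (simp add: fun_eq_iff algebra_simps)
  moreover have "(p i i ^ k * p i j) \<cdot> (?z \<star> word_vec (replicate (Suc r) i))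
        - ?x \<star> (?z \<star> word_vec (replicate r i) - (-1) ^ k \<cdot> sandwich i j k r) \<in> radical p"
    by (intro radical_diff radical_smul radical_conv_left Suc assms)
  ultimately show ?case by (simp only:)
qed (simp add: sandwich_def conv_word_vec del: pointwise)

text \<open>
  Left and right multiplication by \<open>x\<^sub>i\<close> commute, so this is the binomial theorem for their
  difference.
\<close>

lemma lifted_comm_expansion:
  "lifted_comm i j m = (\<Sum>k\<le>m. ((-1) ^ k * of_nat (m choose k)) \<cdot> sandwich i j k (m - k))"
proof (induction m)
  case (Suc m)
  define c :: "nat \<Rightarrow> nat \<Rightarrow> 'a" where "c m k = (-1) ^ k * of_nat (m choose k)" for m k
  have pascal: "c (Suc m) (Suc k) = c m (Suc k) - c m k" for k
    by (simp add: c_def algebra_simps)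
  have "lifted_comm i j (Suc m)
      = (\<Sum>k\<le>m. c m k \<cdot> sandwich i j k (Suc m - k)) - (\<Sum>k\<le>m. c m k \<cdot> sandwich i j (Suc k) (m - k))"
    using Suc
    by (simp add: conv_sum conv_linear sandwich_conv conv_sandwich c_def Suc_diff_le del: pointwise)
  also have "(\<Sum>k\<le>m. c m k \<cdot> sandwich i j k (Suc m - k))
      = (\<Sum>k\<le>Suc m. c m k \<cdot> sandwich i j k (Suc m - k))"
    by (simp add: c_def binomial_eq_0)
  also have "\<dots> = sandwich i j 0 (Suc m) + (\<Sum>k\<le>m. c m (Suc k) \<cdot> sandwich i j (Suc k) (m - k))"
    by (subst sum.atMost_Suc_shift) (simp add: c_def)
  also have "\<dots> - (\<Sum>k\<le>m. c m k \<cdot> sandwich i j (Suc k) (m - k))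
      = sandwich i j 0 (Suc m) + (\<Sum>k\<le>m. c (Suc m) (Suc k) \<cdot> sandwich i j (Suc k) (m - k))"
    by (simp add: pascal smul_diff_left sum_subtractf)
  also have "\<dots> = (\<Sum>k\<le>Suc m. c (Suc m) k \<cdot> sandwich i j k (Suc m - k))"
    by (subst sum.atMost_Suc_shift) (simp add: c_def)
  finally show ?case by (simp only: c_def)
qed (simp add: sandwich_def)

lemma replicate_in_radical_mono:
  assumes "word_vec (replicate r i) \<in> radical p" "r \<le> k"
  shows "word_vec (replicate k i) \<in> radical p"
proof -
  have "word_vec (replicate k i)
      = word_vec (replicate r i) \<star> (word_vec (replicate (k - r) i) :: nat list \<Rightarrow> 'a)"
    using assms(2) by (simp add: conv_word_vec flip: replicate_add)
  then show ?thesis using assms(1) by (simp only: radical_conv_right)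
qed

lemma sandwich_in_radical:
  assumes "word_vec (replicate (Suc r) i) \<in> radical p" "r < k \<or> r < l"
  shows "sandwich i j k l \<in> radical p"
proof -
  have eq: "sandwich i j k l = word_vec (replicate k i) \<star>
      (word_vec [j] \<star> (word_vec (replicate l i) :: nat list \<Rightarrow> 'a))"
    by (simp add: sandwich_def conv_word_vec)
  show ?thesis
    using assms(2) unfolding eq
    by (meson Suc_leI assms(1) radical_conv_left radical_conv_right replicate_in_radical_mono)
qed

text \<open>
  Up to sign \<open>sandwich i j r r\<close> is \<open>z\<^sub>r x\<^sub>i\<^sup>r\<close> for \<open>z\<^sub>r = braided_ad p i j r\<close>. The derivation \<open>D\<^sub>i\<close>
  strips off the power, and \<open>D\<^sub>j\<close> turns \<open>z\<^sub>r\<close> into a nonzero multiple of \<open>x\<^sub>i\<^sup>r\<close>.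
\<close>

lemma sandwich_not_in_radical:
  assumes "i \<noteq> j" "word_vec (replicate r i) \<notin> radical p" "word_vec (replicate (Suc r) i) \<in> radical p"
    and "\<And>k. k < r \<Longrightarrow> p i i ^ k * p i j * p j i \<noteq> 1"
  shows "sandwich i j r r \<notin> radical p"
proof
  assume "sandwich i j r r \<in> radical p"
  then have "braided_ad p i j r \<star> word_vec (replicate r i) \<in> radical p"
    using radical_cong[OF braided_ad_conv_replicate[OF assms(3), of j r]]
    by (simp add: radical_smul)
  then have "braided_ad p i j r \<in> radical p"
    by (rule radical_cancel_replicate) (use assms in \<open>simp_all add: skew_der_braided_ad_same\<close>)
  from radical_skew_der[OF this, of j] show False
    using assms by (simp add: skew_der_braided_ad_other radical_smul_iff)
qed

lemma lifted_comm_in_radical_mono: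
  assumes "lifted_comm i j m \<in> radical p" "m \<le> m'"
  shows "lifted_comm i j m' \<in> radical p"
  using assms(2,1)
  by (induction m' rule: dec_induct) (simp_all add: radical_diff radical_conv_left radical_conv_right)

text \<open>
  Characteristic zero enters here: the only term of the expansion for \<open>m = 2 * r\<close> that is not
  in the radical has the coefficient \<open>\<plusminus> (2 * r choose r)\<close>.
\<close>

lemma lifted_comm_in_radical_iff_height:
  fixes p :: "nat \<Rightarrow> nat \<Rightarrow> 'f::field_char_0"
  assumes "i \<noteq> j" "word_vec (replicate r i) \<notin> radical p" "word_vec (replicate (Suc r) i) \<in> radical p"
    and "\<And>k. k < r \<Longrightarrow> p i i ^ k * p i j * p j i \<noteq> 1"
  shows "lifted_comm i j m \<in> radical p \<longleftrightarrow> 2 * r < m"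
proof
  show "lifted_comm i j m \<in> radical p" if "2 * r < m"
    unfolding lifted_comm_expansion
    using that by (intro radical_sum radical_smul sandwich_in_radical[OF assms(3)]) auto
  let ?c = "\<lambda>k. (-1) ^ k * of_nat (2 * r choose k) :: 'f"
  let ?rest = "\<Sum>k\<in>{..2 * r} - {r}. ?c k \<cdot> sandwich i j k (2 * r - k)"
  have "lifted_comm i j (2 * r) = ?c r \<cdot> sandwich i j r r + ?rest"
    unfolding lifted_comm_expansion by (subst sum.remove[of _ r]) (simp_all add: mult_2)
  moreover have "?rest \<in> radical p"
    by (intro radical_sum radical_smul sandwich_in_radical[OF assms(3)]) auto
  ultimately have "lifted_comm i j (2 * r) \<in> radical p \<longleftrightarrow> ?c r \<cdot> sandwich i j r r \<in> radical p"
    by (intro radical_cong) simp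
  then have "lifted_comm i j (2 * r) \<notin> radical p"
    using sandwich_not_in_radical[OF assms] by (simp add: radical_smul_iff)
  then show "2 * r < m" if "lifted_comm i j m \<in> radical p"
    using lifted_comm_in_radical_mono[OF that] not_le by blast
qed

text \<open>
  For \<open>p\<^sub>i\<^sub>i = 1\<close> the set \<open>cartan_exponents p i j\<close> would be empty. So \<open>p\<^sub>i\<^sub>i \<noteq> 1\<close> has a finite
  order \<open>r + 1\<close>, and minimality of \<open>r\<close> provides the nonvanishing of the factors
  \<open>p\<^sub>i\<^sub>i\<^sup>k p\<^sub>i\<^sub>j p\<^sub>j\<^sub>i - 1\<close>.
\<close>

lemma lifted_comm_in_radical_iff_cartan:
  fixes p :: "nat \<Rightarrow> nat \<Rightarrow> 'f::field_char_0"
  assumes "i \<noteq> j" "cartan_exponents p i j \<noteq> {}" "enat (cartan_m p i j) = mult_ord (p i i) - 1"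
    and "p i j * p j i \<noteq> 1"
  shows "lifted_comm i j m \<in> radical p \<longleftrightarrow> \<not> enat m \<le> enat (cartan_m p i j) + mult_ord (p i i) - 1"
proof -
  define r where "r = cartan_m p i j"
  have "\<exists>m. m \<in> cartan_exponents p i j" using assms(2) by blast
  then have r: "r \<in> cartan_exponents p i j"
    unfolding r_def cartan_m_def by (rule LeastI_ex)
  have q: "p i i \<noteq> 1"
    using r assms(4) unfolding cartan_exponents_def by force
  have "enat 0 < mult_ord (p i i)" by (simp add: enat_less_mult_ord_iff)
  moreover have "enat r = mult_ord (p i i) - 1" using assms(3) by (simp only: r_def)
  ultimately have ord: "mult_ord (p i i) = enat (Suc r)"
    by (cases "mult_ord (p i i)") (simp_all add: one_enat_def)
  have small: "p i i ^ k * p i j * p j i \<noteq> 1" if "k < r" for k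
  proof -
    have "k \<notin> cartan_exponents p i j"
      using that unfolding r_def cartan_m_def by (rule not_less_Least)
    then show ?thesis by (simp add: cartan_exponents_def)
  qed
  have "word_vec (replicate r i) \<notin> radical p" "word_vec (replicate (Suc r) i) \<in> radical p"
    unfolding replicate_in_radical_iff[of p i, OF q] ord by simp_all
  from lifted_comm_in_radical_iff_height[OF assms(1) this small]
  have "lifted_comm i j m \<in> radical p \<longleftrightarrow> 2 * r < m" .
  moreover have "enat r + mult_ord (p i i) - 1 = enat (2 * r)"
    by (simp add: ord one_enat_def)
  ultimately show ?thesis by (simp add: not_le flip: r_def)
qed

theorem proposition6p2:
  fixes n :: nat
    and p :: "nat \<Rightarrow> nat \<Rightarrow> 'f::{alg_closed_field, field_char_0}"
  assumes "n \<ge> 2"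
    and "\<And>i j. i \<in> {1..n} \<Longrightarrow> j \<in> {1..n} \<Longrightarrow> p i j \<noteq> 0"
  shows
    "(p 1 2 = inverse (p 2 1) \<and> p 1 2 \<noteq> 1 \<longrightarrow>
        (p 1 1 \<noteq> 1 \<longrightarrow>
          (\<forall>m. iter_comm n p 1 2 m \<noteq> \<zero>\<^bsub>nichols_algebra n p\<^esub> \<longleftrightarrow> mult_ord (p 1 1) > enat m)) \<and>
        (p 2 2 \<noteq> 1 \<longrightarrow>
          (\<forall>m. iter_comm n p 2 1 m \<noteq> \<zero>\<^bsub>nichols_algebra n p\<^esub> \<longleftrightarrow> mult_ord (p 2 2) > enat m))) \<and>
     (cartan_exponents p 1 2 \<noteq> {} \<and> enat (cartan_m p 1 2) = mult_ord (p 1 1) - 1 \<and>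
        p 1 2 * p 2 1 \<noteq> 1 \<longrightarrow>
        (\<forall>m. iter_comm n p 1 2 m \<noteq> \<zero>\<^bsub>nichols_algebra n p\<^esub> \<longleftrightarrow>
          enat m \<le> enat (cartan_m p 1 2) + mult_ord (p 1 1) - 1)) \<and>
     (cartan_exponents p 2 1 \<noteq> {} \<and> enat (cartan_m p 2 1) = mult_ord (p 2 2) - 1 \<and>
        p 1 2 * p 2 1 \<noteq> 1 \<longrightarrow>
        (\<forall>m. iter_comm n p 2 1 m \<noteq> \<zero>\<^bsub>nichols_algebra n p\<^esub> \<longleftrightarrow>
          enat m \<le> enat (cartan_m p 2 1) + mult_ord (p 2 2) - 1))"
proof -
  have letters: "1 \<in> {1..n}" "2 \<in> {1..n}" using assms(1) by auto
  have nz: "p 2 1 \<noteq> 0" using assms(2) letters by blast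
  note zero_iff = iter_comm_eq_zero_iff[OF letters] iter_comm_eq_zero_iff[OF letters(2,1)]
  have plane: "p 1 2 * p 2 1 = 1" "p 2 1 * p 1 2 = 1" "p 2 1 \<noteq> 1"
    if "p 1 2 = inverse (p 2 1) \<and> p 1 2 \<noteq> 1"
    using that nz by auto
  show ?thesis
    unfolding zero_iff
  proof (intro conjI impI allI)
    fix m
    assume h: "p 1 2 = inverse (p 2 1) \<and> p 1 2 \<noteq> 1"
    show "lifted_comm 1 2 m \<notin> radical p \<longleftrightarrow> enat m < mult_ord (p 1 1)" if "p 1 1 \<noteq> 1"
      using lifted_comm_in_radical_iff_quantum_plane[of 1 2 p m] plane[OF h] that by simp
    show "lifted_comm 2 1 m \<notin> radical p \<longleftrightarrow> enat m < mult_ord (p 2 2)" if "p 2 2 \<noteq> 1"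
      using lifted_comm_in_radical_iff_quantum_plane[of 2 1 p m] plane[OF h] h that by simp
  next
    fix m
    assume h: "cartan_exponents p 1 2 \<noteq> {} \<and> enat (cartan_m p 1 2) = mult_ord (p 1 1) - 1 \<and>
        p 1 2 * p 2 1 \<noteq> 1"
    show "lifted_comm 1 2 m \<notin> radical p \<longleftrightarrow> enat m \<le> enat (cartan_m p 1 2) + mult_ord (p 1 1) - 1"
      using lifted_comm_in_radical_iff_cartan[of 1 2 p m] h by (simp only:) simp
  next
    fix m
    assume h: "cartan_exponents p 2 1 \<noteq> {} \<and> enat (cartan_m p 2 1) = mult_ord (p 2 2) - 1 \<and>
        p 1 2 * p 2 1 \<noteq> 1"
    then have "p 2 1 * p 1 2 \<noteq> 1" by (simp add: mult.commute)
    then show "lifted_comm 2 1 m \<notin> radical p \<longleftrightarrow> enat m \<le> enat (cartan_m p 2 1) + mult_ord (p 2 2) - 1"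
      using lifted_comm_in_radical_iff_cartan[of 2 1 p m] h by (simp only:) simp
  qed
qed

end
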